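(* Let $f$ be a complex-valued function that is continuous on $\overline{\mathbb{U}}$ and harmonic in the unit disk $\mathbb{U}$, and suppose that the closed curve $\gamma_f(t)=f(e^{it})$, $t\in[0,2\pi]$, is rectifiable. Let $L$ be the length of $\gamma_f$ and let $d$ be the diameter of $f(\mathbb{U})$. Then (i) $\pi\Lambda_f(0)\le 2d$; (ii) $2d\le L$. For every $d>0$, the function $u_d(z)=\frac{d}{\pi}\arg\frac{1+z}{1-z}$ on $\mathbb{U}$ (whose image has diameter $d$) satisfies (i) with equality.
   Context: $\mathbb{U}$ is the open unit disk in $\mathbb{C}$. $\Lambda_f(z)=|\partial f(z)|+|\bar\partial f(z)|$, which is the operator norm of the differential of $f$ at $z$. The argument in $u_d$ takes values in $(-\pi/2,\pi/2)$. *)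

theory Defs
  imports "HOL-Analysis.Analysis"
begin

section \<open>Real partial derivatives and harmonic functions\<close>

definition dx :: "(complex \<Rightarrow> complex) \<Rightarrow> complex \<Rightarrow> complex" where
  "dx f z = vector_derivative (\<lambda>t. f (z + of_real t)) (at 0)"

definition dy :: "(complex \<Rightarrow> complex) \<Rightarrow> complex \<Rightarrow> complex" where
  "dy f z = vector_derivative (\<lambda>t. f (z + \<i> * of_real t)) (at 0)"

text \<open>The predicate \<open>differentiable_on\<close> refers to real (Frechet) differentiability.\<close>

definition C1_on :: "(complex \<Rightarrow> complex) \<Rightarrow> complex set \<Rightarrow> bool" where
  "C1_on f S \<longleftrightarrow> f differentiable_on S \<and> continuous_on S (dx f) \<and> continuous_on S (dy f)"

definition C2_on :: "(complex \<Rightarrow> complex) \<Rightarrow> complex set \<Rightarrow> bool" where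
  "C2_on f S \<longleftrightarrow> C1_on f S \<and> C1_on (dx f) S \<and> C1_on (dy f) S"

definition harmonic_on :: "(complex \<Rightarrow> complex) \<Rightarrow> complex set \<Rightarrow> bool" where
  "harmonic_on f S \<longleftrightarrow> open S \<and> C2_on f S \<and> (\<forall>z\<in>S. dx (dx f) z + dy (dy f) z = 0)"

section \<open>Wirtinger derivatives\<close>

definition wirtinger :: "(complex \<Rightarrow> complex) \<Rightarrow> complex \<Rightarrow> complex" where
  "wirtinger f z = (dx f z - \<i> * dy f z) / 2"

definition wirtinger_bar :: "(complex \<Rightarrow> complex) \<Rightarrow> complex \<Rightarrow> complex" where
  "wirtinger_bar f z = (dx f z + \<i> * dy f z) / 2"

definition Lam :: "(complex \<Rightarrow> complex) \<Rightarrow> complex \<Rightarrow> real" where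
  "Lam f z = norm (wirtinger f z) + norm (wirtinger_bar f z)"

section \<open>Rectifiable curves and their length\<close>

text \<open>Lengths of the polygons inscribed in a curve \<open>g\<close> on \<open>[a, b]\<close>, one for each
  subdivision \<open>a = t 0 \<le> t 1 \<le> \<dots> \<le> t n = b\<close>.\<close>

definition inscribed_lengths :: "(real \<Rightarrow> 'a::metric_space) \<Rightarrow> real \<Rightarrow> real \<Rightarrow> real set" where
  "inscribed_lengths g a b =
     {(\<Sum>i<n. dist (g (t i)) (g (t (Suc i)))) | (n::nat) t.
        t 0 = a \<and> t n = b \<and> (\<forall>i<n. t i \<le> t (Suc i))}"

definition rectifiable :: "(real \<Rightarrow> 'a::metric_space) \<Rightarrow> real \<Rightarrow> real \<Rightarrow> bool" where
  "rectifiable g a b \<longleftrightarrow> continuous_on {a..b} g \<and> bdd_above (inscribed_lengths g a b)"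

text \<open>Only meaningful for rectifiable curves.\<close>

definition curve_length :: "(real \<Rightarrow> 'a::metric_space) \<Rightarrow> real \<Rightarrow> real \<Rightarrow> real" where
  "curve_length g a b = Sup (inscribed_lengths g a b)"

definition boundary_curve :: "(complex \<Rightarrow> complex) \<Rightarrow> real \<Rightarrow> complex" where
  "boundary_curve f t = f (exp (\<i> * of_real t))"

section \<open>The extremal function\<close>

definition u_extremal :: "real \<Rightarrow> complex \<Rightarrow> complex" where
  "u_extremal d z = of_real (d / pi * Arg ((1 + z) / (1 - z)))"

text \<open>On the unit disk the principal argument used above is the branch with values in
  \<open>(- pi / 2, pi / 2)\<close>.\<close>

lemma Arg_extremal_range:
  assumes "z \<in> ball 0 1"
  shows "Arg ((1 + z) / (1 - z)) \<in> {- pi / 2 <..< pi / 2}"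
proof -
  have n: "norm z < 1" using assms by simp
  then have z1: "1 - z \<noteq> 0" "1 + z \<noteq> 0"
    using norm_minus_cancel[of z] by (auto simp: add_eq_0_iff)
  have sq: "(Re z)\<^sup>2 + (Im z)\<^sup>2 < 1"
    using n by (metis cmod_power2 norm_ge_zero one_power2 power_strict_mono pos2)
  have "Re ((1 + z) / (1 - z)) = (1 - ((Re z)\<^sup>2 + (Im z)\<^sup>2)) / ((1 - Re z)\<^sup>2 + (Im z)\<^sup>2)"
    by (simp add: Re_divide power2_eq_square algebra_simps)
  also have "\<dots> > 0"
  proof -
    have "(1 - Re z)\<^sup>2 + (Im z)\<^sup>2 = (norm (1 - z))\<^sup>2" by (simp add: cmod_power2)
    then have "(1 - Re z)\<^sup>2 + (Im z)\<^sup>2 > 0" using z1 by simp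
    then show ?thesis using sq by simp
  qed
  finally have pos: "0 < Re ((1 + z) / (1 - z))" .
  have nz: "(1 + z) / (1 - z) \<noteq> 0" using z1 by simp
  have "\<bar>Im (Ln ((1 + z) / (1 - z)))\<bar> < pi / 2"
    using Re_Ln_pos_lt[OF nz] pos by blast
  then show ?thesis unfolding Arg_eq_Im_Ln[OF nz] greaterThanLessThan_iff by linarith
qed

end

theory Submission
  imports Defs "HOL-Complex_Analysis.Conformal_Mappings"
begin

text \<open>
  Both inequalities reduce to one-dimensional shadows of \<open>f\<close>. For a unit complex number \<open>c\<close>
  the real function \<open>Re (c * f)\<close> is harmonic, hence the real part of a holomorphic \<open>F\<close> on the
  disk (\<open>harmonic_real_part_of_holomorphic\<close>), and its oscillation is at most that of \<open>f\<close>.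

  Inequality (i). The gradient of \<open>Re (c * f)\<close> is the conjugate of \<open>F'\<close>, and a suitable
  \<open>c\<close> gives it length \<open>\<Lambda>\<^sub>f\<close> at \<open>0\<close>: the norm of a differential is attained by one of its
  real components (\<open>Lam_eq_norm_gradient\<close>). The function \<open>G z = F z - F (- z)\<close> vanishes at
  \<open>0\<close>, has \<open>G' 0 = 2 F' 0\<close>, and its real part is a difference of two values of \<open>Re (c * f)\<close>,
  so it lies in \<open>[-d, d]\<close>. Antisymmetrising thus replaces the diameter of the image by a strip
  centred at \<open>0\<close>. Mapping the strip conformally to the disk by a scaled tangent and applying the
  Schwarz lemma gives \<open>\<pi> |G' 0| \<le> 4 d\<close> (\<open>deriv_bound_strip\<close>), that is
  \<open>\<pi> \<Lambda>\<^sub>f \<le> 2 d\<close>.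

  Inequality (ii). By the maximum principle for \<open>Re (c * f)\<close>, where \<open>c\<close> rotates
  \<open>f z - f w\<close> onto the positive real axis, \<open>|f z - f w|\<close> is at most some
  \<open>|f \<zeta> - f \<eta>|\<close> with \<open>\<zeta>\<close> and \<open>\<eta>\<close> on the circle
  (\<open>oscillation_le_boundary_oscillation\<close>). These two points cut the closed boundary curve into two
  arcs, each at least as long as the chord between them (\<open>curve_length_ge_double_chord\<close>).

  The extremal function is \<open>d / \<pi>\<close> times the imaginary part of \<open>Ln ((1 + z) / (1 - z))\<close>,
  whose derivative at \<open>0\<close> is \<open>2\<close>. Its values on the imaginary diameter already fill
  \<open>(- d / 2, d / 2)\<close>.
\<close>

section \<open>Symmetry of mixed partial derivatives\<close>

text \<open>The partial derivatives are limits along the axes and would exist for some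
  non-differentiable functions; real differentiability makes them the matrix of the differential.\<close>

lemma has_derivative_dx_dy:
  assumes "f differentiable (at z)"
  shows "(f has_derivative (\<lambda>h. Re h *\<^sub>R dx f z + Im h *\<^sub>R dy f z)) (at z)"
proof -
  obtain f' where f': "(f has_derivative f') (at z)"
    using assms by (auto simp: differentiable_def)
  interpret bounded_linear f' using f' by (rule has_derivative_bounded_linear)
  have along: "((\<lambda>t. f (z + a * of_real t)) has_vector_derivative f' a) (at 0)" for a
  proof -
    have "((\<lambda>t. z + a * of_real t) has_vector_derivative a) (at 0)"
      by (auto intro!: derivative_eq_intros)
    moreover have "(f has_derivative f') (at (z + a * of_real 0))" using f' by simp
    ultimately show ?thesis
      using vector_derivative_diff_chain_within[of "\<lambda>t. z + a * of_real t" a 0 UNIV f f']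
      by (simp add: o_def has_derivative_at_withinI)
  qed
  have "dx f z = f' 1" "dy f z = f' \<i>"
    using along[of 1] along[of \<i>] by (simp_all add: dx_def dy_def vector_derivative_at)
  moreover have "f' h = Re h *\<^sub>R f' 1 + Im h *\<^sub>R f' \<i>" for h
  proof -
    have "h = Re h *\<^sub>R 1 + Im h *\<^sub>R \<i>" by (simp add: complex_eq_iff)
    then show ?thesis by (metis add scaleR)
  qed
  ultimately show ?thesis using f' by (metis (no_types, lifting) ext)
qed

lemma has_real_derivative_along_line:
  fixes l :: "complex \<Rightarrow> real"
  assumes "f differentiable (at w)" and l: "bounded_linear l"
  shows "((\<lambda>t. l (f (w + complex_of_real t * a))) has_real_derivative
            l (Re a *\<^sub>R dx f w + Im a *\<^sub>R dy f w)) (at 0)"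
proof -
  have "((\<lambda>t. w + of_real t * a) has_vector_derivative a) (at 0)"
    by (auto intro!: derivative_eq_intros)
  moreover have "(f has_derivative (\<lambda>h. Re h *\<^sub>R dx f w + Im h *\<^sub>R dy f w))
      (at (w + of_real 0 * a) within range (\<lambda>t. w + of_real t * a))"
    using has_derivative_dx_dy[OF assms(1)] by (simp add: has_derivative_at_withinI)
  ultimately have "((\<lambda>t. f (w + of_real t * a)) has_vector_derivative
      Re a *\<^sub>R dx f w + Im a *\<^sub>R dy f w) (at 0)"
    using vector_derivative_diff_chain_within by (fastforce simp: o_def)
  from bounded_linear.has_vector_derivative[OF l this]
  show ?thesis by (simp add: has_real_derivative_iff_has_vector_derivative)
qed

text \<open>The second difference of \<open>f\<close> over a parallelogram is symmetric in its two directions,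
  whereas the mean value theorem, applied along \<open>a\<close> and then along \<open>b\<close>, expresses it by the
  mixed derivative in that order. Using it for both orders shows that mixed derivatives agree.\<close>

lemma rectangle_mean_value:
  fixes f fa fab :: "complex \<Rightarrow> real"
  assumes fa: "\<And>w. w \<in> ball z r \<Longrightarrow>
        ((\<lambda>t. f (w + of_real t * a)) has_real_derivative fa w) (at 0)"
    and fab: "\<And>w. w \<in> ball z r \<Longrightarrow>
        ((\<lambda>t. fa (w + of_real t * b)) has_real_derivative fab w) (at 0)"
    and a: "norm a = 1" and b: "norm b = 1" and h: "0 < h" "2 * h < r"
  shows "\<exists>\<xi>\<in>cball z (2 * h). f (z + of_real h * a + of_real h * b) - f (z + of_real h * a)
            - f (z + of_real h * b) + f z = h\<^sup>2 * fab \<xi>"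
proof -
  have near: "norm (of_real s * a + of_real t * b) \<le> 2 * h"
    if "0 \<le> s" "s \<le> h" "0 \<le> t" "t \<le> h" for s t
    using norm_triangle_ineq[of "of_real s * a" "of_real t * b"] that a b by (simp add: norm_mult)
  have dz: "dist z (z + v) = norm v" for v by (simp add: dist_norm)
  have inb: "z + of_real s * a + of_real t * b \<in> ball z r"
    if "0 \<le> s" "s \<le> h" "0 \<le> t" "t \<le> h" for s t
    using near[OF that] h by (simp add: dz add.assoc)
  have da: "((\<lambda>t. f (w + of_real t * a)) has_real_derivative fa (w + of_real s * a)) (at s)"
    if "w + of_real s * a \<in> ball z r" for w s
  proof -
    have "((\<lambda>t. f (w + of_real (t + s) * a)) has_real_derivative fa (w + of_real s * a)) (at 0)"
      using fa[OF that] by (simp add: algebra_simps)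
    then show ?thesis
      using DERIV_shift[of "\<lambda>t. f (w + of_real t * a)" _ 0 s] by simp
  qed
  have db: "((\<lambda>t. fa (w + of_real t * b)) has_real_derivative fab (w + of_real s * b)) (at s)"
    if "w + of_real s * b \<in> ball z r" for w s
  proof -
    have "((\<lambda>t. fa (w + of_real (t + s) * b)) has_real_derivative fab (w + of_real s * b)) (at 0)"
      using fab[OF that] by (simp add: algebra_simps)
    then show ?thesis
      using DERIV_shift[of "\<lambda>t. fa (w + of_real t * b)" _ 0 s] by simp
  qed
  define \<phi> where "\<phi> s = f (z + of_real h * b + of_real s * a) - f (z + of_real s * a)" for s
  have "DERIV \<phi> s :> fa (z + of_real h * b + of_real s * a) - fa (z + of_real s * a)"
    if "0 \<le> s" "s \<le> h" for s
    unfolding \<phi>_def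
    using inb[of s h] inb[of s 0] that h
    by (intro DERIV_diff da) (simp_all add: algebra_simps)
  from MVT2[OF h(1) this] obtain s where s: "0 < s" "s < h"
    and 1: "\<phi> h - \<phi> 0 = h * (fa (z + of_real h * b + of_real s * a) - fa (z + of_real s * a))"
    by auto
  have "DERIV (\<lambda>t. fa (z + of_real s * a + of_real t * b)) t
          :> fab (z + of_real s * a + of_real t * b)" if "0 \<le> t" "t \<le> h" for t
    using inb[of s t] s that by (intro db) auto
  from MVT2[OF h(1) this] obtain t where t: "0 < t" "t < h"
    and 2: "fa (z + of_real s * a + of_real h * b) - fa (z + of_real s * a)
              = h * fab (z + of_real s * a + of_real t * b)"
    by auto
  have "z + of_real s * a + of_real t * b \<in> cball z (2 * h)"
    using near[of s t] s t by (simp add: dz add.assoc)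
  moreover have "\<phi> h - \<phi> 0 = h\<^sup>2 * fab (z + of_real s * a + of_real t * b)"
    using 1 2 by (simp add: power2_eq_square algebra_simps)
  ultimately show ?thesis
    by (intro bexI[of _ "z + of_real s * a + of_real t * b"]) (auto simp: \<phi>_def algebra_simps)
qed

text \<open>The mean value theorem fails for complex values, so the equality is proved after
  applying an arbitrary real functional \<open>l\<close>. On every small square at \<open>z\<close> the two mixed
  derivatives coincide at some pair of points; as the square shrinks, continuity brings the equality
  to \<open>z\<close>.\<close>

lemma mixed_partials_eq:
  assumes S: "open S" "z \<in> S" and C: "C2_on f S"
  shows "dy (dx f) z = dx (dy f) z"
proof -
  obtain r where r: "r > 0" "ball z r \<subseteq> S" using S openE by blast
  have diff: "f differentiable (at w)" "dx f differentiable (at w)" "dy f differentiable (at w)"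
    if "w \<in> ball z r" for w
    using C r(2) that S(1) unfolding C2_on_def C1_on_def differentiable_on_def
    by (auto simp: at_within_open[OF _ S(1)] dest!: bspec)
  have cont: "isCont (dy (dx f)) z" "isCont (dx (dy f)) z"
    using C S unfolding C2_on_def C1_on_def by (auto simp: continuous_on_eq_continuous_at)
  have "l (dy (dx f) z) = l (dx (dy f) z)" if l: "bounded_linear l" for l :: "complex \<Rightarrow> real"
  proof -
    define h where "h n = r / 4 / real (Suc n)" for n
    have h: "0 < h n" "2 * h n < r" for n
      using r(1) by (auto simp: h_def field_simps add_pos_nonneg)
    have "\<forall>n. \<exists>\<xi> \<eta>. \<xi> \<in> cball z (2 * h n) \<and> \<eta> \<in> cball z (2 * h n) \<and>
            l (dy (dx f) \<xi>) = l (dx (dy f) \<eta>)"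
    proof
      fix n
      note L = has_real_derivative_along_line[OF _ l]
      have "\<exists>\<xi>\<in>cball z (2 * h n). l (f (z + of_real (h n) * 1 + of_real (h n) * \<i>)) - l (f (z + of_real (h n) * 1))
              - l (f (z + of_real (h n) * \<i>)) + l (f z) = (h n)\<^sup>2 * l (dy (dx f) \<xi>)"
      proof (rule rectangle_mean_value[where r = r and fa = "\<lambda>w. l (dx f w)"])
        show "((\<lambda>t. l (f (w + of_real t * 1))) has_real_derivative l (dx f w)) (at 0)"
          if "w \<in> ball z r" for w
          using L[OF diff(1)[OF that], of 1] by simp
        show "((\<lambda>t. l (dx f (w + of_real t * \<i>))) has_real_derivative l (dy (dx f) w)) (at 0)"
          if "w \<in> ball z r" for w
          using L[OF diff(2)[OF that], of \<i>] by simp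
      qed (use h in auto)
      then obtain \<xi> where \<xi>: "\<xi> \<in> cball z (2 * h n)"
        "l (f (z + of_real (h n) * 1 + of_real (h n) * \<i>)) - l (f (z + of_real (h n) * 1))
              - l (f (z + of_real (h n) * \<i>)) + l (f z) = (h n)\<^sup>2 * l (dy (dx f) \<xi>)"
        by blast
      have "\<exists>\<xi>\<in>cball z (2 * h n). l (f (z + of_real (h n) * \<i> + of_real (h n) * 1)) - l (f (z + of_real (h n) * \<i>))
              - l (f (z + of_real (h n) * 1)) + l (f z) = (h n)\<^sup>2 * l (dx (dy f) \<xi>)"
      proof (rule rectangle_mean_value[where r = r and fa = "\<lambda>w. l (dy f w)"])
        show "((\<lambda>t. l (f (w + of_real t * \<i>))) has_real_derivative l (dy f w)) (at 0)"
          if "w \<in> ball z r" for w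
          using L[OF diff(1)[OF that], of \<i>] by simp
        show "((\<lambda>t. l (dy f (w + of_real t * 1))) has_real_derivative l (dx (dy f) w)) (at 0)"
          if "w \<in> ball z r" for w
          using L[OF diff(3)[OF that], of 1] by simp
      qed (use h in auto)
      then obtain \<eta> where \<eta>: "\<eta> \<in> cball z (2 * h n)"
        "l (f (z + of_real (h n) * \<i> + of_real (h n) * 1)) - l (f (z + of_real (h n) * \<i>))
              - l (f (z + of_real (h n) * 1)) + l (f z) = (h n)\<^sup>2 * l (dx (dy f) \<eta>)"
        by blast
      have "(h n)\<^sup>2 * l (dy (dx f) \<xi>) = (h n)\<^sup>2 * l (dx (dy f) \<eta>)"
        using \<xi>(2) \<eta>(2) by (simp add: algebra_simps)
      with h(1)[of n] \<xi>(1) \<eta>(1) show "\<exists>\<xi> \<eta>. \<xi> \<in> cball z (2 * h n) \<and> \<eta> \<in> cball z (2 * h n) \<and>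
            l (dy (dx f) \<xi>) = l (dx (dy f) \<eta>)" by auto
    qed
    then obtain \<xi> \<eta> where \<xi>: "\<And>n. \<xi> n \<in> cball z (2 * h n)" and \<eta>: "\<And>n. \<eta> n \<in> cball z (2 * h n)"
      and eq: "\<And>n. l (dy (dx f) (\<xi> n)) = l (dx (dy f) (\<eta> n))" by metis
    have "(\<lambda>n. 2 * (r / 4 / real (Suc n))) \<longlonglongrightarrow> 2 * 0"
      by (intro tendsto_mult tendsto_const LIMSEQ_Suc[OF lim_const_over_n])
    then have h0: "(\<lambda>n. 2 * h n) \<longlonglongrightarrow> 0" by (simp add: h_def)
    have lim: "g \<longlonglongrightarrow> z" if "\<And>n. g n \<in> cball z (2 * h n)" for g
      unfolding tendsto_dist_iff[of g]
    proof (rule tendsto_sandwich[where f = "\<lambda>_. 0" and h = "\<lambda>n. 2 * h n"])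
      show "\<forall>\<^sub>F n in sequentially. dist (g n) z \<le> 2 * h n"
        using that by (auto simp: dist_commute)
    qed (use h0 in auto)
    have "(\<lambda>n. l (dy (dx f) (\<xi> n))) \<longlonglongrightarrow> l (dy (dx f) z)"
      by (intro bounded_linear.tendsto[OF l] isCont_tendsto_compose[OF cont(1)] lim \<xi>)
    moreover have "(\<lambda>n. l (dx (dy f) (\<eta> n))) \<longlonglongrightarrow> l (dx (dy f) z)"
      by (intro bounded_linear.tendsto[OF l] isCont_tendsto_compose[OF cont(2)] lim \<eta>)
    ultimately show ?thesis using eq LIMSEQ_unique by simp
  qed
  from this[OF bounded_linear_Re] this[OF bounded_linear_Im] show ?thesis
    by (simp add: complex_eq_iff)
qed

section \<open>Harmonic functions as real parts of holomorphic functions\<close>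

text \<open>With \<open>u = Re (c * f)\<close>, the function \<open>p = u\<^sub>x - \<i> u\<^sub>y\<close> satisfies the Cauchy-Riemann
  equations: one is the Laplace equation, the other the symmetry of the mixed derivatives. A
  primitive of \<open>p\<close>, which exists on a convex set, has a real part with the same gradient as
  \<open>u\<close>. The factor \<open>c\<close> is part of the statement so that every direction of the target plane
  can be used without a separate proof that \<open>c * f\<close> is harmonic.\<close>

lemma harmonic_real_part_of_holomorphic:
  assumes S: "convex S" and f: "harmonic_on f S"
  obtains F where "F holomorphic_on S"
    and "\<And>z. z \<in> S \<Longrightarrow> Re (F z) = Re (c * f z)"
    and "\<And>z. z \<in> S \<Longrightarrow>
      (F has_field_derivative Complex (Re (c * dx f z)) (- Re (c * dy f z))) (at z)"
proof -
  have op: "open S" and C: "C2_on f S"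
    and lap: "\<And>z. z \<in> S \<Longrightarrow> dx (dx f) z + dy (dy f) z = 0"
    using f by (auto simp: harmonic_on_def)
  have diff: "f differentiable (at w)" "dx f differentiable (at w)" "dy f differentiable (at w)"
    if "w \<in> S" for w
    using C that op unfolding C2_on_def C1_on_def differentiable_on_def
    by (auto simp: at_within_open[OF _ op] dest!: bspec)
  define p where "p z = of_real (Re (c * dx f z)) - \<i> * of_real (Re (c * dy f z))" for z
  have "(p has_field_derivative of_real (Re (c * dx (dx f) z)) - \<i> * of_real (Re (c * dx (dy f) z))) (at z)"
    if z: "z \<in> S" for z
  proof -
    have xy: "dy (dx f) z = dx (dy f) z" using mixed_partials_eq[OF op z C] .
    have yy: "dy (dy f) z = - dx (dx f) z" using lap[OF z] by (simp add: add_eq_0_iff)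
    show ?thesis
      unfolding has_field_derivative_def p_def
      by (rule derivative_eq_intros has_derivative_dx_dy[OF diff(2)[OF z]]
            has_derivative_dx_dy[OF diff(3)[OF z]] refl)+
         (auto simp: fun_eq_iff complex_eq_iff xy yy algebra_simps)
  qed
  then have "p holomorphic_on S"
    using op by (auto simp: holomorphic_on_open)
  then obtain G where G: "\<And>z. z \<in> S \<Longrightarrow> (G has_field_derivative p z) (at z within S)"
    using holomorphic_convex_primitive'[OF S op] by metis
  have G: "(G has_field_derivative p z) (at z)" if "z \<in> S" for z
    using G[OF that] unfolding at_within_open[OF that op] .
  have "((\<lambda>z. Re (G z) - Re (c * f z)) has_derivative (\<lambda>h. 0)) (at z within S)"
    if z: "z \<in> S" for z
  proof -
    have "(\<lambda>h. Re (p z * h) - Re (c * (Re h *\<^sub>R dx f z + Im h *\<^sub>R dy f z))) = (\<lambda>h. 0)"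
      by (simp add: fun_eq_iff p_def algebra_simps)
    then have "((\<lambda>z. Re (G z) - Re (c * f z)) has_derivative (\<lambda>h. 0)) (at z)"
      using has_derivative_diff[OF has_derivative_Re[OF G[OF z, unfolded has_field_derivative_def]]
          has_derivative_Re[OF has_derivative_mult_right[OF has_derivative_dx_dy[OF diff(1)[OF z]], of c]]]
      by simp
    then show ?thesis by (rule has_derivative_at_withinI)
  qed
  from has_derivative_zero_constant[OF S this]
  obtain k where k: "\<And>z. z \<in> S \<Longrightarrow> Re (G z) - Re (c * f z) = k" by blast
  show thesis
  proof
    have D: "((\<lambda>z. G z - of_real k) has_field_derivative p z) (at z)" if "z \<in> S" for z
      using G[OF that] by (auto intro!: derivative_eq_intros)
    then show "(\<lambda>z. G z - of_real k) holomorphic_on S"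
      using op by (auto simp: holomorphic_on_open)
    show "Re (G z - of_real k) = Re (c * f z)" if "z \<in> S" for z using k[OF that] by simp
    show "((\<lambda>z. G z - of_real k) has_field_derivative
        Complex (Re (c * dx f z)) (- Re (c * dy f z))) (at z)" if "z \<in> S" for z
    proof -
      have "p z = Complex (Re (c * dx f z)) (- Re (c * dy f z))"
        by (simp add: p_def complex_eq_iff)
      then show ?thesis using D[OF that] by simp
    qed
  qed
qed

section \<open>The gradient at the centre and the diameter of the image\<close>

text \<open>The strip of half-width \<open>\<pi> / 4\<close> is carried into the unit disk by the tangent, because
  \<open>|cos w|\<^sup>2 - |sin w|\<^sup>2 = cos (2 Re w)\<close>.\<close>

lemma tan_strip_into_disk:
  assumes "\<bar>Re w\<bar> < pi / 4"
  shows "cos w \<noteq> 0" "norm (tan w) < 1"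
proof -
  have "0 < cos (2 * Re w)" using assms by (intro cos_gt_zero_pi) auto
  moreover have "(norm (cos w))\<^sup>2 - (norm (sin w))\<^sup>2 = cos (2 * Re w)"
    unfolding norm_sin_squared norm_cos_squared
    by (simp add: exp_double cos_double_cos) (simp add: power2_eq_square field_simps)
  ultimately have lt: "(norm (sin w))\<^sup>2 < (norm (cos w))\<^sup>2" by simp
  then show "cos w \<noteq> 0" by auto
  from lt have "norm (sin w) < norm (cos w)" by (rule power2_less_imp_less) simp
  then show "norm (tan w) < 1" by (simp add: tan_def norm_divide divide_less_eq)
qed

text \<open>This is the Schwarz lemma for \<open>tan (k * F)\<close>, with \<open>k\<close> scaling the strip to half-width
  \<open>\<pi> / 4\<close>.\<close>

lemma deriv_bound_strip:
  assumes F: "F holomorphic_on ball 0 1" and "F 0 = 0"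
    and bd: "\<And>z. z \<in> ball 0 1 \<Longrightarrow> \<bar>Re (F z)\<bar> \<le> B"
  shows "pi * norm (deriv F 0) \<le> 4 * B"
proof (rule field_le_epsilon)
  fix e :: real assume e: "e > 0"
  \<comment> \<open>The tangent needs an open strip, hence one slightly wider than \<open>B\<close>; dividing by \<open>A\<close>
    also needs \<open>A > 0\<close>, which may fail for \<open>B\<close>.\<close>
  define A where "A = B + e / 4"
  have "0 \<le> B" using bd[of 0] by simp
  then have A: "A > 0" "B < A" using e by (auto simp: A_def)
  define k :: complex where "k = of_real (pi / (4 * A))"
  have Re_k: "\<bar>Re (k * F z)\<bar> < pi / 4" if "z \<in> ball 0 1" for z
  proof -
    have "\<bar>Re (k * F z)\<bar> = pi / (4 * A) * \<bar>Re (F z)\<bar>"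
      using A by (simp add: k_def abs_mult flip: of_real_divide)
    also have "\<dots> < pi / (4 * A) * A"
      using A bd[OF that] by (intro mult_strict_left_mono) auto
    finally show ?thesis using A by simp
  qed
  let ?T = "\<lambda>z. tan (k * F z)"
  have "?T holomorphic_on ball 0 1"
    using tan_strip_into_disk(1)[OF Re_k] F unfolding tan_def
    by (intro holomorphic_intros holomorphic_on_cos holomorphic_on_sin) auto
  then have "norm (deriv ?T 0) \<le> 1"
    using Schwarz_Lemma(2)[of ?T 0] tan_strip_into_disk(2)[OF Re_k] \<open>F 0 = 0\<close> by simp
  moreover have "deriv ?T 0 = k * deriv F 0"
  proof (rule DERIV_imp_deriv)
    have "(F has_field_derivative deriv F 0) (at 0)"
      using F by (simp add: holomorphic_derivI)
    then show "(?T has_field_derivative k * deriv F 0) (at 0)"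
      using \<open>F 0 = 0\<close> by (auto intro!: derivative_eq_intros)
  qed
  ultimately have "pi / (4 * A) * norm (deriv F 0) \<le> 1"
    using A by (simp add: k_def norm_mult norm_divide)
  then show "pi * norm (deriv F 0) \<le> 4 * B + e"
    using A by (simp add: field_simps A_def)
qed

text \<open>Writing \<open>a\<close> and \<open>b\<close> for the two Wirtinger derivatives, the gradient of
  \<open>Re (c * f)\<close> is \<open>c a + cnj (c b)\<close> up to conjugation. The two terms point in the same
  direction, so that their norms add up, once \<open>c\<close> undoes the mean of the arguments of \<open>a\<close>
  and \<open>b\<close>.\<close>

lemma Lam_eq_norm_gradient:
  obtains c where "norm c = 1"
    and "norm (Complex (Re (c * dx f z)) (- Re (c * dy f z))) = Lam f z"
proof -
  define a b where "a = wirtinger f z" and "b = wirtinger_bar f z"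
  define \<alpha> \<beta> where "\<alpha> = Arg a" and "\<beta> = Arg b"
  have xy: "dx f z = a + b" "dy f z = \<i> * (a - b)"
    by (simp_all add: a_def b_def wirtinger_def wirtinger_bar_def field_simps)
  define c where "c = cis (- (\<alpha> + \<beta>) / 2)"
  have polar: "a = of_real (norm a) * cis \<alpha>" "b = of_real (norm b) * cis \<beta>"
    using rcis_cmod_Arg[of a] rcis_cmod_Arg[of b] by (simp_all add: \<alpha>_def \<beta>_def rcis_def)
  have "- (\<alpha> + \<beta>) / 2 + \<alpha> = (\<alpha> - \<beta>) / 2" "- (\<alpha> + \<beta>) / 2 + \<beta> = (\<beta> - \<alpha>) / 2"
    by (simp_all add: field_simps)
  then have rot: "c * cis \<alpha> = cis ((\<alpha> - \<beta>) / 2)" "c * cis \<beta> = cis ((\<beta> - \<alpha>) / 2)"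
    unfolding c_def cis_mult by (simp_all only:)
  have ca: "c * a = of_real (norm a) * cis ((\<alpha> - \<beta>) / 2)"
    and cb: "c * b = of_real (norm b) * cis ((\<beta> - \<alpha>) / 2)"
    by (subst polar, simp only: mult.left_commute[of c] rot)+
  have "Complex (Re (c * dx f z)) (- Re (c * dy f z)) = c * a + cnj (c * b)"
    by (simp add: xy complex_eq_iff algebra_simps)
  also have "\<dots> = of_real (norm a + norm b) * cis ((\<alpha> - \<beta>) / 2)"
  proof -
    have "- ((\<beta> - \<alpha>) / 2) = (\<alpha> - \<beta>) / 2" by (simp add: field_simps)
    then have "cnj (c * b) = of_real (norm b) * cis ((\<alpha> - \<beta>) / 2)"
      by (simp only: cb complex_cnj_mult complex_cnj_complex_of_real cis_cnj)
    then show ?thesis by (simp only: ca of_real_add distrib_right)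
  qed
  also have "norm \<dots> = Lam f z"
    by (simp add: norm_mult a_def b_def Lam_def del: of_real_add)
  finally show thesis using that[of c] by (simp add: c_def)
qed

text \<open>Bounding \<open>Re (c * f)\<close> itself would require the centre of its range; the antisymmetric
  part \<open>z \<mapsto> f z - f (- z)\<close> is centred already and keeps the full derivative at \<open>0\<close>
  up to the factor \<open>2\<close>.\<close>

lemma pi_Lam_le_twice_oscillation:
  assumes f: "harmonic_on f (ball 0 1)"
    and osc: "\<And>z w. z \<in> ball 0 1 \<Longrightarrow> w \<in> ball 0 1 \<Longrightarrow> dist (f z) (f w) \<le> d"
  shows "pi * Lam f 0 \<le> 2 * d"
proof -
  obtain c where c: "norm c = 1"
    and grad: "norm (Complex (Re (c * dx f 0)) (- Re (c * dy f 0))) = Lam f 0"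
    by (rule Lam_eq_norm_gradient)
  obtain F where holF: "F holomorphic_on ball 0 1"
    and ReF: "\<And>z. z \<in> ball 0 1 \<Longrightarrow> Re (F z) = Re (c * f z)"
    and dF: "\<And>z. z \<in> ball 0 1 \<Longrightarrow>
      (F has_field_derivative Complex (Re (c * dx f z)) (- Re (c * dy f z))) (at z)"
    using harmonic_real_part_of_holomorphic[OF convex_ball f, of c] by blast
  define G where "G z = F z - F (- z)" for z
  have "(\<lambda>z. F (- z)) holomorphic_on ball 0 1"
    using holomorphic_on_compose_gen[OF holomorphic_on_minus[OF holomorphic_on_ident] holF, of "ball 0 1"]
    by (auto simp: o_def image_subset_iff)
  then have "G holomorphic_on ball 0 1"
    unfolding G_def using holF by (intro holomorphic_on_diff)
  moreover have "\<bar>Re (G z)\<bar> \<le> d" if z: "z \<in> ball 0 1" for z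
  proof -
    have mz: "- z \<in> ball 0 1" using z by simp
    have "Re (G z) = Re (c * (f z - f (- z)))"
      using ReF[OF z] ReF[OF mz] by (simp add: G_def algebra_simps)
    then have "\<bar>Re (G z)\<bar> \<le> norm (c * (f z - f (- z)))" by (simp only: abs_Re_le_cmod)
    also have "\<dots> \<le> d" using osc[OF z mz] c by (simp add: norm_mult dist_norm)
    finally show ?thesis .
  qed
  ultimately have "pi * norm (deriv G 0) \<le> 4 * d"
    by (intro deriv_bound_strip) (auto simp: G_def)
  moreover have "deriv G 0 = 2 * Complex (Re (c * dx f 0)) (- Re (c * dy f 0))"
  proof (rule DERIV_imp_deriv)
    let ?D = "Complex (Re (c * dx f 0)) (- Re (c * dy f 0))"
    have D: "(F has_field_derivative ?D) (at 0)" using dF[of 0] by simp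
    then have "((\<lambda>z. F (- z)) has_field_derivative ?D * (- 1)) (at 0)"
      by (intro DERIV_chain2[where f = F]) (auto intro!: derivative_eq_intros)
    from DERIV_diff[OF D this] show "(G has_field_derivative 2 * ?D) (at 0)"
      by (simp add: G_def[abs_def])
  qed
  ultimately show ?thesis using grad by (simp add: norm_mult)
qed

section \<open>The diameter of the image and the length of the boundary curve\<close>

text \<open>The maximum modulus principle is applied to \<open>exp F\<close> on the open disk, since
  \<open>|exp F| = exp u\<close> there. Only \<open>u\<close>, not \<open>F\<close>, is known to extend to the circle; so a
  maximum at an interior point makes \<open>u\<close> constant on the open disk and then, by continuity of
  \<open>u\<close>, on the closed disk, where it is attained at \<open>1\<close> too.\<close>

lemma Re_maximum_on_sphere:
  assumes F: "F holomorphic_on ball 0 1"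
    and u: "continuous_on (cball 0 1) u" "\<And>z. z \<in> ball 0 1 \<Longrightarrow> u z = Re (F z)"
  obtains \<zeta> :: complex where "norm \<zeta> = 1" "\<And>z. z \<in> cball 0 1 \<Longrightarrow> u z \<le> u \<zeta>"
proof -
  obtain m where m: "m \<in> cball 0 1" "\<And>z. z \<in> cball 0 1 \<Longrightarrow> u z \<le> u m"
    using continuous_attains_sup[OF compact_cball _ u(1)] by force
  show thesis
  proof (cases "norm m = 1")
    case True
    then show thesis using that m by blast
  next
    case False
    then have mb: "m \<in> ball 0 1" using m(1) by simp
    have "(\<lambda>z. exp (F z)) constant_on ball 0 1"
    proof (rule maximum_modulus_principle[where U = "ball 0 1" and \<xi> = m])
      show "(\<lambda>z. exp (F z)) holomorphic_on ball 0 1" using F by (intro holomorphic_intros)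
      show "norm (exp (F z)) \<le> norm (exp (F m))" if "z \<in> ball 0 1" for z
        using m(2)[of z] u(2)[OF that] u(2)[OF mb] that by simp
    qed (use mb in auto)
    then obtain k where k: "\<And>z. z \<in> ball 0 1 \<Longrightarrow> exp (F z) = k"
      by (auto simp: constant_on_def)
    have um: "u z = u m" if "z \<in> ball 0 1" for z
    proof -
      have "norm (exp (F z)) = norm (exp (F m))" using k[OF that] k[OF mb] by simp
      then show ?thesis using u(2)[OF that] u(2)[OF mb] by simp
    qed
    have "u z = u m" if "z \<in> cball 0 1" for z
      using continuous_constant_on_closure[of "ball 0 1" u "u m" z] u(1) um that by simp
    from this[of 1] show thesis using that[of 1] m(2) by simp
  qed
qed

text \<open>The polygon through \<open>g a\<close>, \<open>g s\<close>, \<open>g t\<close> and \<open>g b = g a\<close> is a triangle, so its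
  side from \<open>g s\<close> to \<open>g t\<close> is at most half of its perimeter.\<close>

lemma curve_length_ge_double_chord:
  assumes rect: "rectifiable g a b" and st: "a \<le> s" "s \<le> t" "t \<le> b" and closed: "g a = g b"
  shows "2 * dist (g s) (g t) \<le> curve_length g a b"
proof -
  define T where "T i = (if i = 0 then a else if i = 1 then s else if i = 2 then t else b)" for i :: nat
  let ?P = "dist (g a) (g s) + dist (g s) (g t) + dist (g t) (g b)"
  have "?P = (\<Sum>i<3. dist (g (T i)) (g (T (Suc i))))"
    by (simp add: T_def eval_nat_numeral)
  moreover have "\<forall>i<3. T i \<le> T (Suc i)" using st by (auto simp: T_def)
  moreover have "T 0 = a" "T 3 = b" by (auto simp: T_def)
  ultimately have "?P \<in> inscribed_lengths g a b" unfolding inscribed_lengths_def by blast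
  then have "?P \<le> curve_length g a b"
    unfolding curve_length_def using rect by (intro cSup_upper) (auto simp: rectifiable_def)
  moreover have "dist (g s) (g t) \<le> dist (g a) (g s) + dist (g t) (g b)"
    using dist_triangle[of "g s" "g t" "g a"] closed by (simp add: dist_commute)
  ultimately show ?thesis by simp
qed

text \<open>After a rotation by \<open>c\<close> the distance of \<open>f z\<close> and \<open>f w\<close> is a difference of values of
  one real harmonic function, which is at most the difference of its maximum and its minimum, both
  attained on the circle.\<close>

lemma oscillation_le_boundary_oscillation:
  assumes cont: "continuous_on (cball 0 1) f" and f: "harmonic_on f (ball 0 1)"
    and bd: "\<And>\<zeta> \<eta>. norm \<zeta> = 1 \<Longrightarrow> norm \<eta> = 1 \<Longrightarrow> dist (f \<zeta>) (f \<eta>) \<le> D"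
    and z: "z \<in> ball 0 1" and w: "w \<in> ball 0 1"
  shows "dist (f z) (f w) \<le> D"
proof -
  have max_on_circle: "\<exists>\<zeta>. norm \<zeta> = 1 \<and> (\<forall>z\<in>ball 0 1. Re (c * f z) \<le> Re (c * f \<zeta>))" for c
  proof -
    obtain F where F: "F holomorphic_on ball 0 1"
      "\<And>z. z \<in> ball 0 1 \<Longrightarrow> Re (F z) = Re (c * f z)"
      by (rule harmonic_real_part_of_holomorphic[OF convex_ball f, where c = c]) (rule that)
    have "continuous_on (cball 0 1) (\<lambda>z. Re (c * f z))"
      using cont by (intro continuous_intros)
    then obtain \<zeta> where "norm \<zeta> = 1" "\<And>z. z \<in> cball 0 1 \<Longrightarrow> Re (c * f z) \<le> Re (c * f \<zeta>)"
      by (rule Re_maximum_on_sphere[OF F(1) _ F(2)[symmetric]]) (assumption, rule that)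
    then show ?thesis by (intro exI[of _ \<zeta>]) auto
  qed
  define c where "c = cis (- Arg (f z - f w))"
  have c: "norm c = 1" by (simp add: c_def)
  have "c * (f z - f w) = c * rcis (norm (f z - f w)) (Arg (f z - f w))"
    by (simp add: rcis_cmod_Arg)
  also have "\<dots> = of_real (dist (f z) (f w))"
    by (simp add: c_def rcis_def cis_mult dist_norm)
  finally have "dist (f z) (f w) = Re (c * (f z - f w))" by simp
  then have "dist (f z) (f w) = Re (c * f z) + Re ((- c) * f w)"
    by (simp add: algebra_simps)
  moreover obtain \<zeta> where \<zeta>: "norm \<zeta> = 1" "Re (c * f z) \<le> Re (c * f \<zeta>)"
    using max_on_circle[of c] z by blast
  moreover obtain \<eta> where \<eta>: "norm \<eta> = 1" "Re ((- c) * f w) \<le> Re ((- c) * f \<eta>)"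
    using max_on_circle[of "- c"] w by blast
  moreover have "Re (c * f \<zeta>) + Re ((- c) * f \<eta>) \<le> D"
  proof -
    have "Re (c * f \<zeta>) + Re ((- c) * f \<eta>) = Re (c * (f \<zeta> - f \<eta>))"
      by (simp add: algebra_simps)
    also have "\<dots> \<le> norm (c * (f \<zeta> - f \<eta>))" by (rule complex_Re_le_cmod)
    also have "\<dots> \<le> D" using bd[OF \<zeta>(1) \<eta>(1)] c by (simp add: norm_mult dist_norm)
    finally show ?thesis .
  qed
  ultimately show ?thesis by linarith
qed

text \<open>Transfers the chord estimate from parameters to points: every point of the circle is
  \<open>exp (\<i> t)\<close> for some \<open>t\<close> in the parameter interval, and the two points may occur in
  either order.\<close>

lemma boundary_chord_le_half_length:
  assumes rect: "rectifiable (boundary_curve f) 0 (2 * pi)"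
    and "norm \<zeta> = 1" "norm \<eta> = 1"
  shows "dist (f \<zeta>) (f \<eta>) \<le> curve_length (boundary_curve f) 0 (2 * pi) / 2"
proof -
  have "\<exists>s. 0 \<le> s \<and> s \<le> 2 * pi \<and> f \<xi> = boundary_curve f s" if "norm \<xi> = 1" for \<xi>
    using Arg2pi[of \<xi>] that
    by (intro exI[of _ "Arg2pi \<xi>"]) (auto simp: boundary_curve_def is_Arg_def)
  with assms(2,3) obtain s t where s: "0 \<le> s" "s \<le> 2 * pi" "f \<zeta> = boundary_curve f s"
    and t: "0 \<le> t" "t \<le> 2 * pi" "f \<eta> = boundary_curve f t" by meson
  have closed: "boundary_curve f 0 = boundary_curve f (2 * pi)"
    by (simp add: boundary_curve_def mult_ac)
  show ?thesis
  proof (cases "s \<le> t")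
    case True
    then show ?thesis
      using curve_length_ge_double_chord[OF rect s(1) True t(2) closed] s t by simp
  next
    case False
    then show ?thesis
      using curve_length_ge_double_chord[OF rect t(1) _ s(2) closed] s t by (simp add: dist_commute)
  qed
qed

section \<open>The extremal function\<close>

lemma u_extremal_eq_Im_Ln:
  assumes "z \<in> ball 0 1"
  shows "u_extremal d z = of_real (d / pi * Im (Ln ((1 + z) / (1 - z))))"
proof -
  have "1 + z \<noteq> 0" "1 - z \<noteq> 0"
    using assms norm_minus_cancel[of z] by (auto simp: add_eq_0_iff)
  then show ?thesis by (simp add: u_extremal_def Arg_eq_Im_Ln)
qed

text \<open>The Cayley map sends \<open>\<i> tan \<phi>\<close> to \<open>cis (2 * \<phi>)\<close>, so on this diameter the values of
  the extremal function are explicit.\<close>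

lemma u_extremal_imaginary_axis:
  assumes "\<bar>\<phi>\<bar> < pi / 4"
  shows "\<i> * of_real (tan \<phi>) \<in> ball 0 1"
    and "u_extremal d (\<i> * of_real (tan \<phi>)) = of_real (2 * d * \<phi> / pi)"
proof -
  have c: "cos \<phi> > 0" using assms by (intro cos_gt_zero_pi) auto
  have "\<bar>tan \<phi>\<bar> < 1"
    using tan_strip_into_disk(2)[of "of_real \<phi>"] assms
    by (metis Re_complex_of_real norm_of_real tan_of_real)
  then show "\<i> * of_real (tan \<phi>) \<in> ball 0 1" by (simp add: norm_mult)
  have "(1 + \<i> * of_real (tan \<phi>)) / (1 - \<i> * of_real (tan \<phi>)) = cis \<phi> / cis (- \<phi>)"
  proof -
    have "1 + \<i> * of_real (tan \<phi>) = cis \<phi> / of_real (cos \<phi>)"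
      "1 - \<i> * of_real (tan \<phi>) = cis (- \<phi>) / of_real (cos \<phi>)"
      using c by (auto simp: complex_eq_iff tan_def)
    then show ?thesis using c by simp
  qed
  also have "\<dots> = cis (2 * \<phi>)" by (simp add: cis_divide)
  finally show "u_extremal d (\<i> * of_real (tan \<phi>)) = of_real (2 * d * \<phi> / pi)"
    using assms Arg_cis[of "2 * \<phi>"] by (auto simp: u_extremal_def abs_if split: if_splits)
qed

text \<open>The diameter is a supremum that is not attained: each \<open>x < d\<close> is realised as the distance
  between the values at a conjugate pair of points on the imaginary axis.\<close>

lemma diameter_u_extremal:
  assumes "d > 0"
  shows "diameter (u_extremal d ` ball 0 1) = d"
proof (rule antisym)
  have le: "norm (u_extremal d z - u_extremal d w) \<le> d" if "z \<in> ball 0 1" "w \<in> ball 0 1" for z w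
  proof -
    let ?A = "\<lambda>z. Arg ((1 + z) / (1 - z))"
    have "\<bar>?A z - ?A w\<bar> \<le> pi"
      using Arg_extremal_range[OF that(1)] Arg_extremal_range[OF that(2)] by auto
    then have "d / pi * \<bar>?A z - ?A w\<bar> \<le> d / pi * pi"
      using assms by (intro mult_left_mono) auto
    moreover have "norm (u_extremal d z - u_extremal d w) = d / pi * \<bar>?A z - ?A w\<bar>"
      using assms unfolding u_extremal_def of_real_diff[symmetric] right_diff_distrib[symmetric]
        norm_of_real by (simp add: abs_mult)
    ultimately show ?thesis by simp
  qed
  then show "diameter (u_extremal d ` ball 0 1) \<le> d"
    using assms by (intro diameter_le) auto
  have "norm (u_extremal d z) \<le> d" if "z \<in> ball 0 1" for z
    using le[OF that, of 0] by (simp add: u_extremal_def)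
  then have bdd: "bounded (u_extremal d ` ball 0 1)" unfolding bounded_iff by blast
  show "d \<le> diameter (u_extremal d ` ball 0 1)"
  proof (rule dense_le_bounded[OF assms])
    fix x assume x: "0 < x" "x < d"
    \<comment> \<open>The values at \<open>\<i> tan \<phi>\<close> and \<open>- \<i> tan \<phi>\<close> differ by \<open>4 d \<phi> / \<pi>\<close>.\<close>
    define \<phi> where "\<phi> = pi * x / (4 * d)"
    have \<phi>: "\<bar>\<phi>\<bar> < pi / 4" using x by (simp add: \<phi>_def field_simps)
    then have \<phi>': "\<bar>- \<phi>\<bar> < pi / 4" by simp
    have "dist (u_extremal d (\<i> * of_real (tan \<phi>))) (u_extremal d (\<i> * of_real (tan (- \<phi>)))) = x"
      using x unfolding u_extremal_imaginary_axis(2)[OF \<phi>] u_extremal_imaginary_axis(2)[OF \<phi>'] dist_of_real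
      by (simp add: \<phi>_def dist_real_def field_simps)
    moreover have "dist (u_extremal d (\<i> * of_real (tan \<phi>))) (u_extremal d (\<i> * of_real (tan (- \<phi>))))
        \<le> diameter (u_extremal d ` ball 0 1)"
      using u_extremal_imaginary_axis(1)[OF \<phi>] u_extremal_imaginary_axis(1)[OF \<phi>']
      by (intro diameter_bounded_bound bdd imageI)
    ultimately show "x \<le> diameter (u_extremal d ` ball 0 1)" by simp
  qed
qed

text \<open>Along the line through \<open>0\<close> with direction \<open>a\<close> the derivative is \<open>d / \<pi>\<close> times
  the imaginary part of \<open>2 a\<close>, because \<open>Ln ((1 + z) / (1 - z))\<close> has derivative \<open>2\<close> at
  \<open>0\<close>. So the gradient is vertical, of length \<open>2 d / \<pi>\<close>.\<close>

lemma Lam_u_extremal: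
  assumes "d > 0"
  shows "pi * Lam (u_extremal d) 0 = 2 * d"
proof -
  have along: "vector_derivative (\<lambda>t. u_extremal d (0 + a * of_real t)) (at 0) = of_real (2 * d / pi * Im a)"
    if a: "norm a = 1" for a
  proof (rule vector_derivative_at, rule has_vector_derivative_transform_within_open)
    have "((\<lambda>z. Ln ((1 + z) / (1 - z))) has_field_derivative 2) (at (a * of_real 0))"
      by (auto intro!: derivative_eq_intros)
    moreover have "((\<lambda>t. a * of_real t) has_vector_derivative a) (at 0)"
      by (auto intro!: derivative_eq_intros)
    ultimately have "((\<lambda>t. Ln ((1 + a * of_real t) / (1 - a * of_real t))) has_vector_derivative a * 2) (at 0)"
      using field_vector_diff_chain_at[of "\<lambda>t. a * of_real t" a 0 "\<lambda>z. Ln ((1 + z) / (1 - z))" 2]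
      by (simp add: o_def)
    moreover have "bounded_linear (\<lambda>w. complex_of_real (d / pi * Im w))"
      by (intro bounded_linear_compose[OF bounded_linear_of_real]
          bounded_linear_compose[OF bounded_linear_mult_right] bounded_linear_Im)
    ultimately have "((\<lambda>t. of_real (d / pi * Im (Ln ((1 + a * of_real t) / (1 - a * of_real t)))))
        has_vector_derivative complex_of_real (2 * d / pi * Im a)) (at 0)"
      using bounded_linear.has_vector_derivative[of "\<lambda>w. complex_of_real (d / pi * Im w)"]
      by (fastforce simp: mult_ac)
    then show "((\<lambda>t. complex_of_real (d / pi * Im (Ln ((1 + a * of_real t) / (1 - a * of_real t)))))
        has_vector_derivative complex_of_real (2 * d / pi * Im a)) (at 0)"
      .
    show "complex_of_real (d / pi * Im (Ln ((1 + a * of_real t) / (1 - a * of_real t))))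
        = u_extremal d (0 + a * of_real t)" if "t \<in> ball 0 1" for t :: real
      using that a by (subst u_extremal_eq_Im_Ln) (auto simp: norm_mult)
  qed auto
  have "dx (u_extremal d) 0 = 0" "dy (u_extremal d) 0 = of_real (2 * d / pi)"
    using along[of 1] along[of \<i>] by (simp_all add: dx_def dy_def)
  then show ?thesis
    using assms by (simp add: Lam_def wirtinger_def wirtinger_bar_def norm_mult norm_divide)
qed

section \<open>The sharp inequalities\<close>

theorem theorem8:
  shows "(\<forall>f :: complex \<Rightarrow> complex. \<forall>L d :: real.
            continuous_on (cball 0 1) f \<and> harmonic_on f (ball 0 1) \<and>
            rectifiable (boundary_curve f) 0 (2 * pi) \<and>
            L = curve_length (boundary_curve f) 0 (2 * pi) \<and>
            d = diameter (f ` ball 0 1) \<longrightarrow>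
              pi * Lam f 0 \<le> 2 * d \<and> 2 * d \<le> L) \<and>
         (\<forall>d :: real. d > 0 \<longrightarrow>
            diameter (u_extremal d ` ball 0 1) = d \<and>
            pi * Lam (u_extremal d) 0 = 2 * d)"
proof (intro conjI allI impI; (elim conjE)?)
  fix f :: "complex \<Rightarrow> complex" and L d :: real
  assume cont: "continuous_on (cball 0 1) f" and f: "harmonic_on f (ball 0 1)"
    and rect: "rectifiable (boundary_curve f) 0 (2 * pi)"
    and L: "L = curve_length (boundary_curve f) 0 (2 * pi)"
    and d: "d = diameter (f ` ball 0 1)"
  have bdd: "bounded (f ` ball 0 1)"
    using compact_imp_bounded[OF compact_continuous_image[OF cont compact_cball]]
    by (rule bounded_subset) (intro image_mono ball_subset_cball)
  show "pi * Lam f 0 \<le> 2 * d"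
    using diameter_bounded_bound[OF bdd] by (intro pi_Lam_le_twice_oscillation[OF f]) (auto simp: d)
  have "dist (f z) (f w) \<le> L / 2" if "z \<in> ball 0 1" "w \<in> ball 0 1" for z w
    using oscillation_le_boundary_oscillation[OF cont f _ that] boundary_chord_le_half_length[OF rect]
    unfolding L by blast
  then have "diameter (f ` ball 0 1) \<le> L / 2"
    by (intro diameter_le) (auto simp: dist_norm)
  then show "2 * d \<le> L" using d by simp
next
  fix d :: real assume "d > 0"
  then show "diameter (u_extremal d ` ball 0 1) = d" "pi * Lam (u_extremal d) 0 = 2 * d"
    by (simp_all add: diameter_u_extremal Lam_u_extremal)
qed

end
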